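(* Let $p$ be a prime and let $s,d,r$ be positive integers with $r\le s$. Let $\mathcal{R}$ be a finite chain ring with maximal ideal $I=(\pi)$ such that $I^{s-1}\neq 0$, $I^s=0$, $p$ is an associate of $\pi^r$, and $\mathcal{R}/I$ is a field with $p^d$ elements. Let $w,z_1,z_2$ be integers with $1\le w\le p^d$, $1\le z_1\le p^d-w+1$ and $1\le z_2\le p^{sd}$, and let $\mathcal{S}=\{S_{i,j}\}_{0\le i,j\le z_1}$ be any family of subsets of $G=H\times H$ (with $H$ the additive group of $\mathcal{R}$) obtained by the construction described in the context. Then $\mathcal{S}$ is a partial sum family if and only if $z_2\in\{w-1,w\}$ in the case $2\le w\le p^d$, and $z_2=1$ in the case $w=1$. Furthermore, in that case its parameters are $$(m,n,k,\lambda,\mu,t)=\bigl(z_1+1,\ p^{2sd},\ (p^{sd}-1)w+z_1z_2p^{sd},\ p^{sd}+w^2-3w+z_1z_2^2,\ w^2-w+z_1z_2^2,\ p^{sd}w-w+z_1z_2^2\bigr).$$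
   Context: A finite chain ring is a finite commutative local ring whose maximal ideal is principal. Here $|\mathcal{R}|=p^{sd}$. Partial sum family: let $G$ be a finite abelian group of order $n$ with identity $e$. A family $\{S_{i,j}\}_{0\le i,j\le m-1}$ of subsets of $G$ is an $(m,n,k,\lambda,\mu,t)$-partial sum family if (1) $e\notin S_{i,i}$ for all $i$; (2) $\sum_{j=0}^{m-1}|S_{i,j}|=\sum_{j=0}^{m-1}|S_{j,i}|=k$ for all $i$; (3) for all $0\le i,j\le m-1$, in the group ring $\mathbb{Z}[G]$ one has $\sum_{l=0}^{m-1}S_{l,j}S_{i,l}=\mu G+\beta S_{i,j}+\delta_{i,j}\gamma e$, where $\beta=\lambda-\mu$, $\gamma=t-\mu$ and $\delta_{i,j}$ is the Kronecker delta. A subset $S\subseteq G$ is identified with $\sum_{g\in S}g\in\mathbb{Z}[G]$. It is a partial sum family if this holds for some parameters. Construction of $\mathcal{S}$: let $0_G=(0,0)$ be the identity of $G=H\times H$. Let $J\subset\mathcal{R}$ be a fixed system of coset representatives of $\mathcal{R}$ modulo $I$, and $J'=J\cup\{\infty\}$. For $a\in J$ put $L_a=\{(x,ax):x\in\mathcal{R}\}$, and put $L_\infty=\{(0,x):x\in\mathcal{R}\}$; these are subgroups of $G$. Label the elements of $J'$ as $a_0=\infty,a_1,\dots,a_{p^d}$. For $0\le i\le j\le p^d$ let $D_{[i,j]}=\{a_i,a_{i+1},\dots,a_j\}$. Choose integers $0\le k_0<k_1<\dots<k_{z_1}\le p^d-w+1$ and put $A_i=D_{[k_i,w+k_i-1]}$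 for $0\le i\le z_1$. For $0\le i\neq j\le z_1$ let $b_{i,j}=a_{k_i}$ if $i<j$ and $b_{i,j}=a_{w+k_i-1}$ if $i>j$, and let $T_{i,j}$ be a set of $z_2$ elements of $G$ lying in pairwise distinct cosets of $L_{b_{i,j}}$ (a size-$z_2$ subset of a system of coset representatives of $L_{b_{i,j}}$ in $G$). Define $$S_{i,i}=\bigcup_{a\in A_i}L_a\setminus\{0_G\}\quad(0\le i\le z_1),\qquad S_{i,j}=\bigcup_{g\in T_{i,j}}(g+L_{b_{i,j}})\quad(0\le i\neq j\le z_1).$$ *)

theory Defs
  imports "HOL-Algebra.Algebra"
begin

definition finite_chain_ring :: "('a, 'b) ring_scheme \<Rightarrow> bool" where
  "finite_chain_ring R \<longleftrightarrow>
     cring R \<and> finite (carrier R) \<and> (\<exists>!M. maximalideal M R) \<and>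
     (\<forall>M. maximalideal M R \<longrightarrow> principalideal M R)"

definition ideal_power :: "('a, 'b) ring_scheme \<Rightarrow> 'a set \<Rightarrow> nat \<Rightarrow> 'a set" where
  "ideal_power R I n = I [^]\<^bsub>ideals_set R\<^esub> n"

definition coset_representatives :: "('a, 'b) ring_scheme \<Rightarrow> 'a set \<Rightarrow> 'a set \<Rightarrow> bool" where
  "coset_representatives R I J \<longleftrightarrow>
     J \<subseteq> carrier R \<and> (\<forall>C \<in> carrier (R Quot I). \<exists>!a. a \<in> J \<inter> C)"

text \<open>Elements of the group ring of \<open>G\<close> are formal integer combinations of elements of \<open>G\<close>,
  that is, members of the type \<^typ>\<open>'g \<Rightarrow>\<^sub>0 int\<close> used by the library for free Abelian groups.
  The product is the bilinear extension of the multiplication of \<open>G\<close>.\<close>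

definition group_ring_mult ::
    "('g, 'b) monoid_scheme \<Rightarrow> ('g \<Rightarrow>\<^sub>0 int) \<Rightarrow> ('g \<Rightarrow>\<^sub>0 int) \<Rightarrow> ('g \<Rightarrow>\<^sub>0 int)" where
  "group_ring_mult G x y =
     frag_extend (\<lambda>g. frag_extend (\<lambda>h. frag_of (g \<otimes>\<^bsub>G\<^esub> h)) y) x"

definition subset_sum :: "'g set \<Rightarrow> ('g \<Rightarrow>\<^sub>0 int)" where
  "subset_sum S = (\<Sum>g\<in>S. frag_of g)"

text \<open>The index range \<open>{0..<m}\<close> is part of the family, so \<open>m\<close> is an argument of both predicates;
  values of \<open>S\<close> outside that range are irrelevant. The parameter \<open>\<lambda>\<close> is written \<open>l\<close>.\<close>

definition partial_sum_family_with ::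
    "('g, 'b) monoid_scheme \<Rightarrow> (nat \<Rightarrow> nat \<Rightarrow> 'g set) \<Rightarrow>
     nat \<Rightarrow> nat \<Rightarrow> nat \<Rightarrow> int \<Rightarrow> int \<Rightarrow> int \<Rightarrow> bool" where
  "partial_sum_family_with G S m n k l \<mu> t \<longleftrightarrow>
     comm_group G \<and> finite (carrier G) \<and> order G = n \<and>
     (\<forall>i<m. \<forall>j<m. S i j \<subseteq> carrier G) \<and>
     (\<forall>i<m. \<one>\<^bsub>G\<^esub> \<notin> S i i) \<and>
     (\<forall>i<m. (\<Sum>j<m. card (S i j)) = k \<and> (\<Sum>j<m. card (S j i)) = k) \<and>
     (\<forall>i<m. \<forall>j<m.
        (\<Sum>h<m. group_ring_mult G (subset_sum (S h j)) (subset_sum (S i h))) =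
          frag_cmul \<mu> (subset_sum (carrier G)) + frag_cmul (l - \<mu>) (subset_sum (S i j))
            + (if i = j then frag_cmul (t - \<mu>) (frag_of \<one>\<^bsub>G\<^esub>) else 0))"

definition is_partial_sum_family ::
    "('g, 'b) monoid_scheme \<Rightarrow> nat \<Rightarrow> (nat \<Rightarrow> nat \<Rightarrow> 'g set) \<Rightarrow> bool" where
  "is_partial_sum_family G m S \<longleftrightarrow> (\<exists>n k l \<mu> t. partial_sum_family_with G S m n k l \<mu> t)"

abbreviation plane_group :: "('a, 'b) ring_scheme \<Rightarrow> ('a \<times> 'a) monoid" where
  "plane_group R \<equiv> add_monoid R \<times>\<times> add_monoid R"

text \<open>Slopes live in \<^typ>\<open>'a option\<close>, with \<^const>\<open>None\<close> playing the role of \<open>\<infinity>\<close>.\<close>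

fun line :: "('a, 'b) ring_scheme \<Rightarrow> 'a option \<Rightarrow> ('a \<times> 'a) set" where
  "line R (Some a) = {(x, a \<otimes>\<^bsub>R\<^esub> x) | x. x \<in> carrier R}"
| "line R None = {(\<zero>\<^bsub>R\<^esub>, x) | x. x \<in> carrier R}"

definition slope_labelling :: "'a set \<Rightarrow> nat \<Rightarrow> (nat \<Rightarrow> 'a option) \<Rightarrow> bool" where
  "slope_labelling J q a \<longleftrightarrow> a 0 = None \<and> bij_betw a {0..q} (insert None (Some ` J))"

definition off_slope ::
    "(nat \<Rightarrow> 'a option) \<Rightarrow> nat \<Rightarrow> (nat \<Rightarrow> nat) \<Rightarrow> nat \<Rightarrow> nat \<Rightarrow> 'a option" where
  "off_slope a w \<kappa> i j = (if i < j then a (\<kappa> i) else a (w + \<kappa> i - 1))"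

definition in_distinct_cosets :: "('g, 'b) monoid_scheme \<Rightarrow> 'g set \<Rightarrow> 'g set \<Rightarrow> bool" where
  "in_distinct_cosets G L T \<longleftrightarrow> T \<subseteq> carrier G \<and> inj_on (\<lambda>g. g <#\<^bsub>G\<^esub> L) T"

definition constructed_family ::
    "('a, 'b) ring_scheme \<Rightarrow> (nat \<Rightarrow> 'a option) \<Rightarrow> nat \<Rightarrow> (nat \<Rightarrow> nat) \<Rightarrow>
     (nat \<Rightarrow> nat \<Rightarrow> ('a \<times> 'a) set) \<Rightarrow> nat \<Rightarrow> nat \<Rightarrow> ('a \<times> 'a) set" where
  "constructed_family R a w \<kappa> T i j =
     (if i = j
      then (\<Union>c \<in> a ` {\<kappa> i..w + \<kappa> i - 1}. line R c) - {\<one>\<^bsub>plane_group R\<^esub>}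
      else (\<Union>g \<in> T i j. g <#\<^bsub>plane_group R\<^esub> line R (off_slope a w \<kappa> i j)))"

end

theory Submission
  imports Defs
begin

text \<open>
  Distinct slopes in \<open>J'\<close> differ by a non-zero-divisor, so the lines \<open>L\<^sub>c\<close> are subgroups of
  order \<open>N = p\<^bsup>sd\<^esup>\<close> of a group of order \<open>N\<^sup>2\<close>, any two of which meet trivially.
  Hence \<open>L\<^sub>c L\<^sub>c = N L\<^sub>c\<close> and \<open>L\<^sub>c L\<^sub>e = G\<close> for \<open>c \<noteq> e\<close> in the group ring, and
  the monotonicity of \<open>\<kappa>\<close> makes the slopes of \<open>S\<^sub>l\<^sub>j\<close> and \<open>S\<^sub>i\<^sub>l\<close> distinct for \<open>l \<noteq> i, j\<close>.
  The diagonal equations have the unique solution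
  \<open>\<beta> = N - 2w\<close>, \<open>\<mu> = w\<^sup>2 - w + z\<^sub>1 z\<^sub>2\<^sup>2\<close>, \<open>\<gamma> = Nw - w\<^sup>2\<close>, while the off-diagonal sums have the
  same \<open>\<beta>\<close> but \<open>\<mu> = (2w - 1) z\<^sub>2 + (z\<^sub>1 - 1) z\<^sub>2\<^sup>2\<close>. The two values of \<open>\<mu>\<close> agree
  exactly when \<open>(z\<^sub>2 - w) (z\<^sub>2 - w + 1) = 0\<close>.
\<close>

section \<open>Products of coset sums in the group ring\<close>

lemma group_ring_mult_add_left:
  "group_ring_mult G (x + y) u = group_ring_mult G x u + group_ring_mult G y u"
  by (simp add: group_ring_mult_def frag_extend_add)

lemma group_ring_mult_diff_left:
  "group_ring_mult G (x - y) u = group_ring_mult G x u - group_ring_mult G y u"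
  by (simp add: group_ring_mult_def frag_extend_diff)

lemma group_ring_mult_sum_left:
  "finite A \<Longrightarrow> group_ring_mult G (sum f A) u = (\<Sum>a\<in>A. group_ring_mult G (f a) u)"
  by (simp add: group_ring_mult_def frag_extend_sum)

text \<open>The right factor of \<open>group_ring_mult\<close> sits inside the function argument of
  the outer \<open>frag_extend\<close>. Linearity on the right therefore needs linearity of
  \<open>frag_extend\<close> in that argument.\<close>

lemma frag_extend_diff_fun: "frag_extend (\<lambda>g. f g - h g) x = frag_extend f x - frag_extend h x"
  by (rule poly_mapping_eqI)
    (simp add: frag_extend_def lookup_sum lookup_minus right_diff_distrib sum_subtractf)

lemma group_ring_mult_diff_right:
  "group_ring_mult G u (x - y) = group_ring_mult G u x - group_ring_mult G u y"
  by (simp add: group_ring_mult_def frag_extend_diff frag_extend_diff_fun)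

lemma group_ring_mult_zero_right [simp]: "group_ring_mult G u 0 = 0"
  by (simp add: group_ring_mult_def frag_extend_def)

lemma group_ring_mult_add_right:
  "group_ring_mult G u (x + y) = group_ring_mult G u x + group_ring_mult G u y"
  using group_ring_mult_diff_right[of G u "x + y" y] by (simp add: algebra_simps)

lemma group_ring_mult_sum_right:
  "finite A \<Longrightarrow> group_ring_mult G u (sum f A) = (\<Sum>a\<in>A. group_ring_mult G u (f a))"
  by (induction A rule: finite_induct) (simp_all add: group_ring_mult_add_right)

lemma group_ring_mult_cmul_right:
  "group_ring_mult G u (frag_cmul k x) = frag_cmul k (group_ring_mult G u x)"
  unfolding group_ring_mult_def frag_extend_cmul
  by (rule poly_mapping_eqI)
    (simp add: frag_extend_def[of _ u] lookup_sum sum_distrib_left ac_simps)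

lemma group_ring_mult_cmul_left:
  "group_ring_mult G (frag_cmul k x) u = frag_cmul k (group_ring_mult G x u)"
  by (simp add: group_ring_mult_def frag_extend_cmul)

lemma group_ring_mult_subset_sum:
  assumes "finite A" "finite B"
  shows "group_ring_mult G (subset_sum A) (subset_sum B) =
    (\<Sum>x\<in>A. \<Sum>y\<in>B. frag_of (x \<otimes>\<^bsub>G\<^esub> y))"
  using assms by (simp add: group_ring_mult_def subset_sum_def frag_extend_sum)

lemma lookup_subset_sum:
  "finite A \<Longrightarrow> Poly_Mapping.lookup (subset_sum A) x = (if x \<in> A then 1 else 0)"
  by (simp add: subset_sum_def lookup_sum)

lemma subset_sum_remove:
  "finite A \<Longrightarrow> x \<in> A \<Longrightarrow> subset_sum (A - {x}) = subset_sum A - frag_of x"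
  by (simp add: subset_sum_def sum_diff1)

lemma subset_sum_UN_disjoint:
  assumes "finite I" "\<And>i. i \<in> I \<Longrightarrow> finite (A i)"
    and "\<And>i j. i \<in> I \<Longrightarrow> j \<in> I \<Longrightarrow> i \<noteq> j \<Longrightarrow> A i \<inter> A j = {}"
  shows "subset_sum (\<Union>i\<in>I. A i) = (\<Sum>i\<in>I. subset_sum (A i))"
  unfolding subset_sum_def using assms by (intro sum.UNION_disjoint) auto

section \<open>Products of cosets in a commutative group\<close>

context comm_group
begin

lemma group_ring_mult_one_left:
  assumes "finite A" "A \<subseteq> carrier G"
  shows "group_ring_mult G (frag_of \<one>) (subset_sum A) = subset_sum A"
proof -
  have "group_ring_mult G (frag_of \<one>) (subset_sum A) = (\<Sum>y\<in>A. frag_of (\<one> \<otimes> y))"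
    using group_ring_mult_subset_sum[of "{\<one>}" A G] assms(1) by (simp add: subset_sum_def)
  then show ?thesis
    using assms(2) by (auto simp: subset_sum_def intro!: sum.cong)
qed

lemma group_ring_mult_one_right:
  assumes "finite A" "A \<subseteq> carrier G"
  shows "group_ring_mult G (subset_sum A) (frag_of \<one>) = subset_sum A"
proof -
  have "group_ring_mult G (subset_sum A) (frag_of \<one>) = (\<Sum>y\<in>A. frag_of (y \<otimes> \<one>))"
    using group_ring_mult_subset_sum[of A "{\<one>}" G] assms(1) by (simp add: subset_sum_def)
  then show ?thesis
    using assms(2) by (auto simp: subset_sum_def intro!: sum.cong)
qed

lemma group_ring_mult_one_one: "group_ring_mult G (frag_of \<one>) (frag_of \<one>) = frag_of \<one>"
  by (simp add: group_ring_mult_def)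

lemma card_l_coset:
  assumes "H \<subseteq> carrier G" "g \<in> carrier G"
  shows "card (g <# H) = card H"
proof -
  have "g <# H = (\<lambda>h. g \<otimes> h) ` H" by (auto simp: l_coset_def)
  then show ?thesis
    using assms by (metis card_image inj_on_cmult inj_on_subset)
qed

text \<open>By commutativity, two equal products yield
  \<open>u \<otimes> v = u' \<otimes> v'\<close>, so
  \<open>inv u' \<otimes> u = v' \<otimes> inv v\<close> lies in \<open>H \<inter> K\<close> and is
  trivial. Injectivity together with \<open>card H * card K = order G\<close> gives
  surjectivity.\<close>

lemma bij_betw_mult_complementary_cosets:
  assumes fin: "finite (carrier G)" and H: "subgroup H G" and K: "subgroup K G"
    and "H \<inter> K = {\<one>}" "card H * card K = order G"
    and g: "g \<in> carrier G" and h: "h \<in> carrier G"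
  shows "bij_betw (\<lambda>(x, y). x \<otimes> y) ((g <# H) \<times> (h <# K)) (carrier G)"
proof -
  note sub = subgroup.subset[OF H] subgroup.subset[OF K]
  have carr: "g <# H \<subseteq> carrier G" "h <# K \<subseteq> carrier G"
    using sub g h l_coset_subset_G by blast+
  have inj: "inj_on (\<lambda>(x, y). x \<otimes> y) ((g <# H) \<times> (h <# K))"
  proof (rule inj_onI, clarify)
    fix x y x' y'
    assume xy: "x \<in> g <# H" "y \<in> h <# K" "x' \<in> g <# H" "y' \<in> h <# K"
      and eq: "x \<otimes> y = x' \<otimes> y'"
    have c: "x \<in> carrier G" "y \<in> carrier G" "x' \<in> carrier G" "y' \<in> carrier G"
      using xy carr by auto
    obtain u u' v v' where uv: "u \<in> H" "u' \<in> H" "v \<in> K" "v' \<in> K"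
      "x = g \<otimes> u" "x' = g \<otimes> u'" "y = h \<otimes> v" "y' = h \<otimes> v'"
      using xy unfolding l_coset_def by auto
    have cc: "u \<in> carrier G" "u' \<in> carrier G" "v \<in> carrier G" "v' \<in> carrier G"
      using uv sub by auto
    have "(g \<otimes> h) \<otimes> (u \<otimes> v) = (g \<otimes> h) \<otimes> (u' \<otimes> v')"
      using eq uv cc g h by (simp add: m_ac)
    then have "u \<otimes> v = u' \<otimes> v'" using cc g h by simp
    then have "inv u' \<otimes> u = v' \<otimes> inv v"
      using cc by (metis inv_closed inv_solve_left' inv_solve_right m_assoc m_closed)
    moreover have "inv u' \<otimes> u \<in> H" "v' \<otimes> inv v \<in> K"
      using uv H K by (auto intro: subgroup.m_closed subgroup.m_inv_closed)
    ultimately have "inv u' \<otimes> u = \<one>" "v' \<otimes> inv v = \<one>" using assms(4) by auto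
    then have "u = u'" "v = v'" using cc
      by (metis inv_closed inv_equality inv_inv, metis cc(3,4) inv_equality inv_inv inv_closed)
    then show "x = x' \<and> y = y'" using uv by simp
  qed
  have "(\<lambda>(x, y). x \<otimes> y) ` ((g <# H) \<times> (h <# K)) \<subseteq> carrier G"
    using carr by auto
  moreover have "card ((\<lambda>(x, y). x \<otimes> y) ` ((g <# H) \<times> (h <# K))) = card (carrier G)"
    using card_image[OF inj] assms(5) g h sub
    by (simp add: card_cartesian_product card_l_coset order_def)
  ultimately show ?thesis
    using inj fin by (simp add: bij_betw_def card_subset_eq)
qed

text \<open>Every group element arises exactly once as a product. The representatives
  \<open>g\<close> and \<open>h\<close> drop out, so later only the number of cosets matters and not
  their choice.\<close>

lemma group_ring_mult_complementary_cosets: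
  assumes "finite (carrier G)" "subgroup H G" "subgroup K G"
    and "H \<inter> K = {\<one>}" "card H * card K = order G"
    and "g \<in> carrier G" "h \<in> carrier G"
  shows "group_ring_mult G (subset_sum (g <# H)) (subset_sum (h <# K)) = subset_sum (carrier G)"
proof -
  have fin: "finite (g <# H)" "finite (h <# K)"
    using assms by (meson finite_subset l_coset_subset_G subgroup.subset)+
  have "group_ring_mult G (subset_sum (g <# H)) (subset_sum (h <# K)) =
      (\<Sum>(x, y)\<in>(g <# H) \<times> (h <# K). frag_of (x \<otimes> y))"
    using fin by (simp add: group_ring_mult_subset_sum sum.cartesian_product)
  also have "\<dots> = (\<Sum>z\<in>carrier G. frag_of z)"
    using sum.reindex_bij_betw[OF bij_betw_mult_complementary_cosets[OF assms], of frag_of]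
    by (simp add: case_prod_unfold)
  finally show ?thesis by (simp add: subset_sum_def)
qed

text \<open>Right translation by an element of \<open>H\<close> permutes \<open>g <# H\<close>, so
  each of the \<open>card H\<close> elements contributes one full copy of the coset.\<close>

lemma group_ring_mult_coset_self:
  assumes "finite (carrier G)" "subgroup H G" "g \<in> carrier G"
  shows "group_ring_mult G (subset_sum (g <# H)) (subset_sum H) =
    frag_cmul (int (card H)) (subset_sum (g <# H))"
proof -
  note sub = subgroup.subset[OF assms(2)]
  have carr: "g <# H \<subseteq> carrier G" using sub assms(3) by (rule l_coset_subset_G)
  have fin: "finite (g <# H)" "finite H"
    using assms(1) carr sub finite_subset by auto
  have "(\<Sum>x\<in>g <# H. frag_of (x \<otimes> y)) = subset_sum (g <# H)" if y: "y \<in> H" for y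
  proof -
    have inj: "inj_on (\<lambda>x. x \<otimes> y) (g <# H)"
      using inj_on_multc[of y] carr y sub inj_on_subset by blast
    have "(\<lambda>x. x \<otimes> y) ` (g <# H) \<subseteq> g <# H"
      using y sub assms(3) subgroup.m_closed[OF assms(2)]
      by (force simp: l_coset_def m_assoc subset_iff)
    then have "bij_betw (\<lambda>x. x \<otimes> y) (g <# H) (g <# H)"
      using inj fin(1) by (simp add: bij_betw_def endo_inj_surj)
    from sum.reindex_bij_betw[OF this, of frag_of] show ?thesis
      by (simp add: subset_sum_def)
  qed
  then have "(\<Sum>y\<in>H. \<Sum>x\<in>g <# H. frag_of (x \<otimes> y)) = (\<Sum>y\<in>H. subset_sum (g <# H))"
    by simp
  also have "\<dots> = frag_cmul (int (card H)) (subset_sum (g <# H))"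
    by (rule poly_mapping_eqI) (simp add: lookup_sum)
  finally show ?thesis
    using fin by (simp add: group_ring_mult_subset_sum sum.swap[of _ H])
qed

end


section \<open>Partial congruence partitions of a group of order \<open>N * N\<close>\<close>

locale line_net = comm_group G for G :: "('g, 'b) monoid_scheme" (structure) +
  fixes N q :: nat and L :: "nat \<Rightarrow> 'g set"
  assumes finite_carrier: "finite (carrier G)"
    and order_eq: "order G = N * N"
    and two_le: "2 \<le> N"
    and subgroup_line: "c \<le> q \<Longrightarrow> subgroup (L c) G"
    and card_line: "c \<le> q \<Longrightarrow> card (L c) = N"
    and line_inter: "c \<le> q \<Longrightarrow> d \<le> q \<Longrightarrow> c \<noteq> d \<Longrightarrow> L c \<inter> L d = {\<one>}"
begin

abbreviation prod_ring (infixl "\<star>" 70) where "x \<star> y \<equiv> group_ring_mult G x y"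

abbreviation star where "star C \<equiv> (\<Union>c\<in>C. L c) - {\<one>}"

abbreviation coset_union where "coset_union c U \<equiv> (\<Union>g\<in>U. g <# L c)"

lemma line_subset: "c \<le> q \<Longrightarrow> L c \<subseteq> carrier G"
  using subgroup_line subgroup.subset by blast

lemma one_in_line: "c \<le> q \<Longrightarrow> \<one> \<in> L c"
  using subgroup_line subgroup.one_closed by blast

lemma finite_line: "c \<le> q \<Longrightarrow> finite (L c)"
  using line_subset finite_carrier finite_subset by blast

lemma coset_subset: "c \<le> q \<Longrightarrow> g \<in> carrier G \<Longrightarrow> g <# L c \<subseteq> carrier G"
  using line_subset l_coset_subset_G by blast

lemma finite_coset: "c \<le> q \<Longrightarrow> g \<in> carrier G \<Longrightarrow> finite (g <# L c)"
  using coset_subset finite_carrier finite_subset by blast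

lemma coset_disjoint:
  assumes "c \<le> q" "g \<in> carrier G" "h \<in> carrier G" "g <# L c \<noteq> h <# L c"
  shows "(g <# L c) \<inter> (h <# L c) = {}"
  using assms subgroup_line by (intro lcos_disjoint[of "L c"]) (auto simp: LCOSETS_def)

lemma coset_union_subset: "c \<le> q \<Longrightarrow> U \<subseteq> carrier G \<Longrightarrow> coset_union c U \<subseteq> carrier G"
  using coset_subset by blast

lemma finite_coset_union: "c \<le> q \<Longrightarrow> U \<subseteq> carrier G \<Longrightarrow> finite (coset_union c U)"
  using coset_union_subset finite_carrier finite_subset by meson

lemma finite_subset_carrier: "U \<subseteq> carrier G \<Longrightarrow> finite U"
  using finite_carrier finite_subset by blast

lemma line_as_coset: "c \<le> q \<Longrightarrow> \<one> <# L c = L c"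
  using line_subset lcos_mult_one by blast

text \<open>All lines share the identity. Removing it from each line separately makes the union
  disjoint, so that sums and cardinalities can be taken line by line.\<close>

lemma star_eq_UN: "star C = (\<Union>c\<in>C. L c - {\<one>})"
  by blast

lemma star_disjoint:
  "C \<subseteq> {..q} \<Longrightarrow> c \<in> C \<Longrightarrow> d \<in> C \<Longrightarrow> c \<noteq> d \<Longrightarrow> (L c - {\<one>}) \<inter> (L d - {\<one>}) = {}"
  using line_inter by blast

text \<open>Each line contains the identity once, so the sum over all lines counts it
  \<open>card C\<close> times, whereas the star omits it. Products are easier for full lines, hence
  this conversion.\<close>

lemma subset_sum_star:
  assumes "C \<subseteq> {..q}"
  shows "subset_sum (star C) = (\<Sum>c\<in>C. subset_sum (L c)) - frag_cmul (int (card C)) (frag_of \<one>)"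
proof -
  have C: "finite C" "\<And>c. c \<in> C \<Longrightarrow> c \<le> q"
    using assms finite_subset by auto
  have "subset_sum (star C) = (\<Sum>c\<in>C. subset_sum (L c - {\<one>}))"
    unfolding star_eq_UN using C finite_line star_disjoint[OF assms]
    by (intro subset_sum_UN_disjoint) auto
  also have "\<dots> = (\<Sum>c\<in>C. subset_sum (L c) - frag_of \<one>)"
    using C finite_line one_in_line by (intro sum.cong) (auto simp: subset_sum_remove)
  also have "\<dots> = (\<Sum>c\<in>C. subset_sum (L c)) - frag_cmul (int (card C)) (frag_of \<one>)"
    by (rule poly_mapping_eqI)
      (simp add: lookup_sum lookup_minus sum_subtractf)
  finally show ?thesis .
qed

lemma card_star:
  assumes "C \<subseteq> {..q}"
  shows "card (star C) = card C * (N - 1)"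
proof -
  have C: "finite C" "\<And>c. c \<in> C \<Longrightarrow> c \<le> q"
    using assms finite_subset by auto
  have "card (star C) = (\<Sum>c\<in>C. card (L c - {\<one>}))"
    unfolding star_eq_UN using C finite_line star_disjoint[OF assms]
    by (intro card_UN_disjoint) auto
  also have "\<dots> = (\<Sum>c\<in>C. N - 1)"
    using C finite_line one_in_line card_line by (intro sum.cong) auto
  finally show ?thesis by simp
qed

lemma subset_sum_coset_union:
  assumes "c \<le> q" "U \<subseteq> carrier G" "inj_on (\<lambda>g. g <# L c) U"
  shows "subset_sum (coset_union c U) = (\<Sum>g\<in>U. subset_sum (g <# L c))"
  using assms finite_subset_carrier finite_coset
  by (intro subset_sum_UN_disjoint coset_disjoint) (auto dest: inj_onD)

lemma card_coset_union:
  assumes "c \<le> q" "U \<subseteq> carrier G" "inj_on (\<lambda>g. g <# L c) U"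
  shows "card (coset_union c U) = card U * N"
proof -
  have "card (coset_union c U) = (\<Sum>g\<in>U. card (g <# L c))"
  proof (intro card_UN_disjoint ballI impI)
    fix g h assume "g \<in> U" "h \<in> U" "g \<noteq> h"
    then show "(g <# L c) \<inter> (h <# L c) = {}"
      using assms by (intro coset_disjoint) (auto dest: inj_onD)
  qed (use assms finite_subset_carrier finite_coset in auto)
  also have "\<dots> = (\<Sum>g\<in>U. N)"
    using assms card_l_coset line_subset card_line by (intro sum.cong) auto
  finally show ?thesis by simp
qed

text \<open>Each pair of cosets of two different lines multiplies to one copy of the whole group,
  and there are \<open>card U * card V\<close> pairs.\<close>

lemma coset_union_mult_coset_union:
  assumes "c \<le> q" "d \<le> q" "c \<noteq> d"
    and "U \<subseteq> carrier G" "inj_on (\<lambda>g. g <# L c) U"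
    and "V \<subseteq> carrier G" "inj_on (\<lambda>g. g <# L d) V"
  shows "subset_sum (coset_union c U) \<star> subset_sum (coset_union d V) =
    frag_cmul (int (card U) * int (card V)) (subset_sum (carrier G))"
proof -
  have fin: "finite U" "finite V"
    using assms finite_subset_carrier by auto
  have "subset_sum (g <# L c) \<star> subset_sum (h <# L d) = subset_sum (carrier G)"
    if "g \<in> U" "h \<in> V" for g h
    using that assms subgroup_line card_line line_inter order_eq finite_carrier
    by (intro group_ring_mult_complementary_cosets) auto
  then have "subset_sum (coset_union c U) \<star> subset_sum (coset_union d V) =
      (\<Sum>g\<in>U. \<Sum>h\<in>V. subset_sum (carrier G))"
    using assms fin by (simp add: subset_sum_coset_union group_ring_mult_sum_left
        group_ring_mult_sum_right sum.swap[of _ V U])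
  also have "\<dots> = frag_cmul (int (card U) * int (card V)) (subset_sum (carrier G))"
    by (rule poly_mapping_eqI) (simp add: lookup_sum)
  finally show ?thesis .
qed

text \<open>A line is the coset union over the single representative \<open>\<one>\<close>.\<close>

lemma coset_union_mult_line:
  assumes "c \<le> q" "d \<le> q" "c \<noteq> d" "U \<subseteq> carrier G" "inj_on (\<lambda>g. g <# L c) U"
  shows "subset_sum (coset_union c U) \<star> subset_sum (L d) =
    frag_cmul (int (card U)) (subset_sum (carrier G))"
  using coset_union_mult_coset_union[OF assms, of "{\<one>}"] assms line_as_coset by simp

lemma line_mult_coset_union:
  assumes "c \<le> q" "d \<le> q" "c \<noteq> d" "U \<subseteq> carrier G" "inj_on (\<lambda>g. g <# L d) U"
  shows "subset_sum (L c) \<star> subset_sum (coset_union d U) =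
    frag_cmul (int (card U)) (subset_sum (carrier G))"
  using coset_union_mult_coset_union[OF assms(1-3), of "{\<one>}" U] assms line_as_coset by simp

lemma line_mult_line:
  assumes "c \<le> q" "d \<le> q"
  shows "subset_sum (L c) \<star> subset_sum (L d) =
    (if c = d then frag_cmul (int N) (subset_sum (L c)) else subset_sum (carrier G))"
  using coset_union_mult_line[OF assms, of "{\<one>}"] group_ring_mult_coset_self[of "L c" \<one>]
    assms subgroup_line finite_carrier card_line line_as_coset by auto

lemma coset_union_mult_line_self:
  assumes "c \<le> q" "U \<subseteq> carrier G" "inj_on (\<lambda>g. g <# L c) U"
  shows "subset_sum (coset_union c U) \<star> subset_sum (L c) =
    frag_cmul (int N) (subset_sum (coset_union c U))"
proof -
  have "subset_sum (g <# L c) \<star> subset_sum (L c) = frag_cmul (int N) (subset_sum (g <# L c))"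
    if "g \<in> U" for g
    using that assms group_ring_mult_coset_self[OF finite_carrier subgroup_line[OF assms(1)]]
      card_line by auto
  then show ?thesis
    using assms finite_subset_carrier
    by (simp add: subset_sum_coset_union group_ring_mult_sum_left frag_cmul_sum)
qed

lemma sum_lines_eq:
  assumes "C \<subseteq> {..q}"
  shows "(\<Sum>c\<in>C. subset_sum (L c)) = subset_sum (star C) + frag_cmul (int (card C)) (frag_of \<one>)"
  using subset_sum_star[OF assms] by simp

text \<open>Of the \<open>card C\<close> squared products, those of a line with itself give
  \<open>N\<close> copies of that line, and each of the remaining
  \<open>card C * (card C - 1)\<close> gives the whole group.\<close>

lemma sum_lines_mult_sum_lines:
  assumes "C \<subseteq> {..q}"
  shows "(\<Sum>c\<in>C. subset_sum (L c)) \<star> (\<Sum>c\<in>C. subset_sum (L c)) =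
    frag_cmul (int N) (\<Sum>c\<in>C. subset_sum (L c)) +
    frag_cmul (int (card C) * (int (card C) - 1)) (subset_sum (carrier G))"
proof -
  have C: "finite C" "\<And>c. c \<in> C \<Longrightarrow> c \<le> q"
    using assms finite_subset by auto
  have "(\<Sum>d\<in>C. subset_sum (L d) \<star> subset_sum (L c)) =
      frag_cmul (int N) (subset_sum (L c)) + frag_cmul (int (card C) - 1) (subset_sum (carrier G))"
    if c: "c \<in> C" for c
  proof -
    \<comment> \<open>Needed to turn the natural number \<open>card C - 1\<close> into an integer
      difference.\<close>
    have pos: "card C \<ge> 1" using C(1) c by (metis One_nat_def Suc_leI card_gt_0_iff empty_iff)
    have "(\<Sum>d\<in>C. subset_sum (L d) \<star> subset_sum (L c)) =
        subset_sum (L c) \<star> subset_sum (L c) +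
        (\<Sum>d\<in>C - {c}. subset_sum (L d) \<star> subset_sum (L c))"
      using C(1) c by (rule sum.remove)
    also have "(\<Sum>d\<in>C - {c}. subset_sum (L d) \<star> subset_sum (L c)) =
        (\<Sum>d\<in>C - {c}. subset_sum (carrier G))"
      using C(2) c by (intro sum.cong) (auto simp: line_mult_line)
    also have "\<dots> = frag_cmul (int (card C) - 1) (subset_sum (carrier G))"
      using C(1) c pos by (intro poly_mapping_eqI) (simp add: lookup_sum of_nat_diff)
    finally show ?thesis
      using C(2) c by (simp add: line_mult_line)
  qed
  then have "(\<Sum>c\<in>C. \<Sum>d\<in>C. subset_sum (L d) \<star> subset_sum (L c)) =
      (\<Sum>c\<in>C. frag_cmul (int N) (subset_sum (L c)) +
        frag_cmul (int (card C) - 1) (subset_sum (carrier G)))"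
    by simp
  also have "\<dots> = frag_cmul (int N) (\<Sum>c\<in>C. subset_sum (L c)) +
    frag_cmul (int (card C) * (int (card C) - 1)) (subset_sum (carrier G))"
    by (rule poly_mapping_eqI)
      (simp add: lookup_sum lookup_add sum.distrib sum_distrib_left algebra_simps)
  finally show ?thesis
    unfolding group_ring_mult_sum_left[OF C(1)] group_ring_mult_sum_right[OF C(1)] .
qed

lemma star_subset: "C \<subseteq> {..q} \<Longrightarrow> star C \<subseteq> carrier G"
  using line_subset by blast

lemma finite_star: "C \<subseteq> {..q} \<Longrightarrow> finite (star C)"
  by (intro finite_subset_carrier star_subset)

text \<open>With \<open>X\<close> the star and \<open>e\<close> the identity, the sum of the lines
  is \<open>X + w e\<close>. The rule for sums of lines gives
  \<open>(X + w e)^2 = N (X + w e) + w (w - 1) G\<close>, which is solved for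
  \<open>X^2\<close>.\<close>

lemma star_mult_star:
  assumes "C \<subseteq> {..q}"
  defines "w \<equiv> int (card C)"
  shows "subset_sum (star C) \<star> subset_sum (star C) =
    frag_cmul (int N - 2 * w) (subset_sum (star C)) +
    frag_cmul (w * (w - 1)) (subset_sum (carrier G)) +
    frag_cmul (int N * w - w\<^sup>2) (frag_of \<one>)"
proof -
  note S = star_subset[OF assms(1)] finite_star[OF assms(1)]
  have "subset_sum (star C) \<star> subset_sum (star C) + frag_cmul w (subset_sum (star C)) +
      (frag_cmul w (subset_sum (star C)) + frag_cmul w (frag_cmul w (frag_of \<one>))) =
    frag_cmul (int N) (subset_sum (star C) + frag_cmul w (frag_of \<one>)) +
    frag_cmul (w * (w - 1)) (subset_sum (carrier G))"
    using sum_lines_mult_sum_lines[OF assms(1)] S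
    unfolding sum_lines_eq[OF assms(1)] w_def[symmetric]
    by (simp only: group_ring_mult_add_left group_ring_mult_add_right group_ring_mult_cmul_left
      group_ring_mult_cmul_right group_ring_mult_one_left group_ring_mult_one_right
      group_ring_mult_one_one frag_cmul_distrib2 ac_simps)
  \<comment> \<open>Passing to coefficients makes the rearrangement an identity of integers.\<close>
  then have "Poly_Mapping.lookup (subset_sum (star C) \<star> subset_sum (star C) +
      frag_cmul w (subset_sum (star C)) +
      (frag_cmul w (subset_sum (star C)) + frag_cmul w (frag_cmul w (frag_of \<one>)))) x =
    Poly_Mapping.lookup (frag_cmul (int N) (subset_sum (star C) + frag_cmul w (frag_of \<one>)) +
    frag_cmul (w * (w - 1)) (subset_sum (carrier G))) x" for x
    by simp
  note * = this[unfolded lookup_add lookup_frag_cmul]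
  show ?thesis
  proof (rule poly_mapping_eqI, unfold lookup_add lookup_frag_cmul)
    fix x
    show "Poly_Mapping.lookup (subset_sum (star C) \<star> subset_sum (star C)) x =
      (int N - 2 * w) * Poly_Mapping.lookup (subset_sum (star C)) x +
      w * (w - 1) * Poly_Mapping.lookup (subset_sum (carrier G)) x +
      (int N * w - w\<^sup>2) * Poly_Mapping.lookup (frag_of \<one>) x"
      using *[of x] by (simp add: algebra_simps power2_eq_square)
  qed
qed

text \<open>The line \<open>b\<close> itself reproduces the coset union \<open>N\<close> times, each
  of the other \<open>card C - 1\<close> lines gives \<open>card U\<close> copies of the group, and
  the missing identities subtract \<open>card C\<close> copies of the coset union.\<close>

lemma coset_union_mult_star:
  assumes "C \<subseteq> {..q}" "b \<in> C" "U \<subseteq> carrier G" "inj_on (\<lambda>g. g <# L b) U"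
  shows "subset_sum (coset_union b U) \<star> subset_sum (star C) =
    frag_cmul (int N - int (card C)) (subset_sum (coset_union b U)) +
    frag_cmul ((int (card C) - 1) * int (card U)) (subset_sum (carrier G))"
proof -
  have C: "finite C" "\<And>c. c \<in> C \<Longrightarrow> c \<le> q"
    using assms finite_subset by auto
  have pos: "card C \<ge> 1" using C(1) assms(2) by (metis One_nat_def Suc_leI card_gt_0_iff empty_iff)
  have "subset_sum (coset_union b U) \<star> (\<Sum>c\<in>C. subset_sum (L c)) =
      (\<Sum>c\<in>C. subset_sum (coset_union b U) \<star> subset_sum (L c))"
    using C(1) by (rule group_ring_mult_sum_right)
  also have "\<dots> = subset_sum (coset_union b U) \<star> subset_sum (L b) +
      (\<Sum>c\<in>C - {b}. subset_sum (coset_union b U) \<star> subset_sum (L c))"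
    using C(1) assms(2) by (rule sum.remove)
  also have "(\<Sum>c\<in>C - {b}. subset_sum (coset_union b U) \<star> subset_sum (L c)) =
      (\<Sum>c\<in>C - {b}. frag_cmul (int (card U)) (subset_sum (carrier G)))"
    using C(2) assms by (intro sum.cong coset_union_mult_line) auto
  also have "\<dots> = frag_cmul ((int (card C) - 1) * int (card U)) (subset_sum (carrier G))"
    using C(1) assms(2) pos
    by (intro poly_mapping_eqI) (simp add: lookup_sum of_nat_diff)
  also have "subset_sum (coset_union b U) \<star> subset_sum (L b) =
      frag_cmul (int N) (subset_sum (coset_union b U))"
    using C(2) assms by (intro coset_union_mult_line_self) auto
  finally show ?thesis
    using finite_coset_union[of b U] coset_union_subset[of b U] C(2) assms
    by (simp add: subset_sum_star group_ring_mult_diff_right group_ring_mult_cmul_right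
        group_ring_mult_one_right frag_cmul_diff_distrib)
qed

text \<open>Here no line of the star is parallel to the cosets, so the coset union enters only
  through the missing identities. For equal \<open>card C = w\<close>, its coefficients in this and
  the previous product add up to \<open>N - 2w\<close>, the coefficient of the star in its own
  square.\<close>

lemma star_mult_coset_union:
  assumes "C \<subseteq> {..q}" "b \<le> q" "b \<notin> C" "U \<subseteq> carrier G" "inj_on (\<lambda>g. g <# L b) U"
  shows "subset_sum (star C) \<star> subset_sum (coset_union b U) =
    frag_cmul (int (card C) * int (card U)) (subset_sum (carrier G)) -
    frag_cmul (int (card C)) (subset_sum (coset_union b U))"
proof -
  have C: "finite C" "\<And>c. c \<in> C \<Longrightarrow> c \<le> q"
    using assms finite_subset by auto
  have "(\<Sum>c\<in>C. subset_sum (L c)) \<star> subset_sum (coset_union b U) =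
      (\<Sum>c\<in>C. subset_sum (L c) \<star> subset_sum (coset_union b U))"
    using C(1) by (rule group_ring_mult_sum_left)
  also have "\<dots> = (\<Sum>c\<in>C. frag_cmul (int (card U)) (subset_sum (carrier G)))"
    using C(2) assms by (intro sum.cong line_mult_coset_union) auto
  also have "\<dots> = frag_cmul (int (card C) * int (card U)) (subset_sum (carrier G))"
    by (rule poly_mapping_eqI) (simp add: lookup_sum)
  finally show ?thesis
    using finite_coset_union[of b U] coset_union_subset[of b U] assms
    by (simp add: subset_sum_star group_ring_mult_diff_left group_ring_mult_cmul_left
        group_ring_mult_one_left)
qed

end

section \<open>Families built from a net of lines\<close>

text \<open>Slopes are represented by their positions in the labelling, so the sets of consecutive
  slopes become intervals of numbers and the distinctness of slopes reduces to inequalities. With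
  \<open>1 \<le> z\<^sub>1\<close> there is at least one off-diagonal equation;
  \<open>w \<le> q\<close> leaves at least one line outside each star.\<close>

locale net_family = line_net +
  fixes w z\<^sub>1 z\<^sub>2 :: nat and \<kappa> :: "nat \<Rightarrow> nat" and T :: "nat \<Rightarrow> nat \<Rightarrow> 'a set"
  assumes w: "1 \<le> w" "w \<le> q" and z\<^sub>1: "1 \<le> z\<^sub>1" and z\<^sub>2: "1 \<le> z\<^sub>2"
    and mono: "strict_mono_on {0..z\<^sub>1} \<kappa>"
    and bound: "i \<le> z\<^sub>1 \<Longrightarrow> \<kappa> i \<le> q - w + 1"
    and card_T: "i \<le> z\<^sub>1 \<Longrightarrow> j \<le> z\<^sub>1 \<Longrightarrow> i \<noteq> j \<Longrightarrow> card (T i j) = z\<^sub>2"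
    and T_cosets: "i \<le> z\<^sub>1 \<Longrightarrow> j \<le> z\<^sub>1 \<Longrightarrow> i \<noteq> j \<Longrightarrow>
      in_distinct_cosets G (L (if i < j then \<kappa> i else w + \<kappa> i - 1)) (T i j)"
begin

definition b where "b i j = (if i < j then \<kappa> i else w + \<kappa> i - 1)"

definition fam where
  "fam i j = (if i = j then star {\<kappa> i..w + \<kappa> i - 1} else coset_union (b i j) (T i j))"

lemma mono_less: "i < j \<Longrightarrow> j \<le> z\<^sub>1 \<Longrightarrow> \<kappa> i < \<kappa> j"
  using strict_mono_onD[OF mono, of i j] by simp

text \<open>The bound \<open>q - w + 1\<close> is what keeps the last position
  \<open>w + \<kappa> i - 1\<close> at most \<open>q\<close>.\<close>

lemma range_subset: "i \<le> z\<^sub>1 \<Longrightarrow> {\<kappa> i..w + \<kappa> i - 1} \<subseteq> {..q}"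
  using bound[of i] w by auto

lemma card_range: "card {\<kappa> i..w + \<kappa> i - 1} = w"
  using w by simp

lemma b_le: "i \<le> z\<^sub>1 \<Longrightarrow> b i j \<le> q"
  using bound[of i] w by (auto simp: b_def)

lemma b_in: "b i j \<in> {\<kappa> i..w + \<kappa> i - 1}"
  using w by (auto simp: b_def)

text \<open>This is the purpose of the two cases for \<open>b\<close>. If \<open>i < j\<close>, the
  interval of \<open>j\<close> starts further right and misses the left end of the interval of
  \<open>i\<close>; if \<open>i > j\<close>, it ends further left and misses the right end.\<close>

lemma b_notin: "i \<le> z\<^sub>1 \<Longrightarrow> j \<le> z\<^sub>1 \<Longrightarrow> i \<noteq> j \<Longrightarrow> b i j \<notin> {\<kappa> j..w + \<kappa> j - 1}"
  using mono_less[of i j] mono_less[of j i] w by (auto simp: b_def)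

text \<open>\<open>b l j\<close> lies in the interval of \<open>l\<close>, and \<open>b i l\<close>
  does not.\<close>

lemma b_neq:
  assumes "i \<le> z\<^sub>1" "l \<le> z\<^sub>1" "i \<noteq> l"
  shows "b l j \<noteq> b i l"
  using b_in[of l j] b_notin[OF assms] by metis

lemma T_subset: "i \<le> z\<^sub>1 \<Longrightarrow> j \<le> z\<^sub>1 \<Longrightarrow> i \<noteq> j \<Longrightarrow> T i j \<subseteq> carrier G"
  using T_cosets[of i j] by (simp add: in_distinct_cosets_def)

lemma T_inj: "i \<le> z\<^sub>1 \<Longrightarrow> j \<le> z\<^sub>1 \<Longrightarrow> i \<noteq> j \<Longrightarrow> inj_on (\<lambda>g. g <# L (b i j)) (T i j)"
  using T_cosets[of i j] by (simp add: in_distinct_cosets_def b_def)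

lemmas T_props = T_subset T_inj card_T b_le

lemma fam_subset: "i \<le> z\<^sub>1 \<Longrightarrow> j \<le> z\<^sub>1 \<Longrightarrow> fam i j \<subseteq> carrier G"
  using star_subset[OF range_subset] coset_union_subset[OF b_le T_subset] by (simp add: fam_def)

lemma finite_fam: "i \<le> z\<^sub>1 \<Longrightarrow> j \<le> z\<^sub>1 \<Longrightarrow> finite (fam i j)"
  by (intro finite_subset_carrier fam_subset)

lemma card_fam:
  "i \<le> z\<^sub>1 \<Longrightarrow> j \<le> z\<^sub>1 \<Longrightarrow> card (fam i j) = (if i = j then (N - 1) * w else z\<^sub>2 * N)"
  using card_star[OF range_subset, of i] card_range[of i] card_coset_union[of "b i j" "T i j"] T_props
  by (auto simp: fam_def mult.commute)

text \<open>The case \<open>i = j\<close> is included, so this covers the generic summands of both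
  the diagonal and the off-diagonal equations.\<close>

lemma off_mult_off:
  assumes "i \<le> z\<^sub>1" "l \<le> z\<^sub>1" "j \<le> z\<^sub>1" "i \<noteq> l" "l \<noteq> j"
  shows "subset_sum (fam l j) \<star> subset_sum (fam i l) =
    frag_cmul ((int z\<^sub>2)\<^sup>2) (subset_sum (carrier G))"
  using coset_union_mult_coset_union[of "b l j" "b i l" "T l j" "T i l"] assms T_props b_neq
  by (simp add: fam_def power2_eq_square)

lemma sum_products_diag:
  assumes "i \<le> z\<^sub>1"
  shows "(\<Sum>l<z\<^sub>1 + 1. subset_sum (fam l i) \<star> subset_sum (fam i l)) =
    frag_cmul ((int w)\<^sup>2 - int w + int z\<^sub>1 * (int z\<^sub>2)\<^sup>2) (subset_sum (carrier G)) +
    frag_cmul (int N - 2 * int w) (subset_sum (fam i i)) +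
    frag_cmul (int N * int w - (int w)\<^sup>2) (frag_of \<one>)"
proof -
  have "(\<Sum>l<z\<^sub>1 + 1. subset_sum (fam l i) \<star> subset_sum (fam i l)) =
      subset_sum (fam i i) \<star> subset_sum (fam i i) +
      (\<Sum>l\<in>{..<z\<^sub>1 + 1} - {i}. subset_sum (fam l i) \<star> subset_sum (fam i l))"
    using assms by (intro sum.remove) auto
  also have "(\<Sum>l\<in>{..<z\<^sub>1 + 1} - {i}. subset_sum (fam l i) \<star> subset_sum (fam i l)) =
      (\<Sum>l\<in>{..<z\<^sub>1 + 1} - {i}. frag_cmul ((int z\<^sub>2)\<^sup>2) (subset_sum (carrier G)))"
    using assms by (intro sum.cong off_mult_off) auto
  also have "\<dots> = frag_cmul (int z\<^sub>1 * (int z\<^sub>2)\<^sup>2) (subset_sum (carrier G))"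
    using assms by (intro poly_mapping_eqI) (simp add: lookup_sum)
  also have "subset_sum (fam i i) \<star> subset_sum (fam i i) =
      frag_cmul (int N - 2 * int w) (subset_sum (fam i i)) +
      frag_cmul (int w * (int w - 1)) (subset_sum (carrier G)) +
      frag_cmul (int N * int w - (int w)\<^sup>2) (frag_of \<one>)"
    using star_mult_star[OF range_subset[OF assms]] unfolding card_range fam_def by simp
  finally show ?thesis
    by (rule trans)
      (intro poly_mapping_eqI, simp add: lookup_add algebra_simps power2_eq_square)
qed

text \<open>The two exceptional summands are \<open>l = i\<close>, where the line
  \<open>b i j\<close> belongs to the star, and \<open>l = j\<close>, where it does not. They
  contribute \<open>(w - 1) z\<^sub>2\<close> and \<open>w z\<^sub>2\<close> copies of the group;
  each of the other \<open>z\<^sub>1 - 1\<close> indices contributes the square of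
  \<open>z\<^sub>2\<close>.\<close>

lemma sum_products_off:
  assumes "i \<le> z\<^sub>1" "j \<le> z\<^sub>1" "i \<noteq> j"
  shows "(\<Sum>l<z\<^sub>1 + 1. subset_sum (fam l j) \<star> subset_sum (fam i l)) =
    frag_cmul ((2 * int w - 1) * int z\<^sub>2 + (int z\<^sub>1 - 1) * (int z\<^sub>2)\<^sup>2) (subset_sum (carrier G)) +
    frag_cmul (int N - 2 * int w) (subset_sum (fam i j))"
proof -
  let ?P = "\<lambda>l. subset_sum (fam l j) \<star> subset_sum (fam i l)"
  have "(\<Sum>l<z\<^sub>1 + 1. ?P l) = ?P i + (\<Sum>l\<in>{..<z\<^sub>1 + 1} - {i}. ?P l)"
    using assms by (intro sum.remove) auto
  also have "(\<Sum>l\<in>{..<z\<^sub>1 + 1} - {i}. ?P l) = ?P j + (\<Sum>l\<in>{..<z\<^sub>1 + 1} - {i} - {j}. ?P l)"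
    using assms by (intro sum.remove) auto
  also have "(\<Sum>l\<in>{..<z\<^sub>1 + 1} - {i} - {j}. ?P l) =
      (\<Sum>l\<in>{..<z\<^sub>1 + 1} - {i} - {j}. frag_cmul ((int z\<^sub>2)\<^sup>2) (subset_sum (carrier G)))"
    using assms by (intro sum.cong off_mult_off) auto
  also have "\<dots> = frag_cmul ((int z\<^sub>1 - 1) * (int z\<^sub>2)\<^sup>2) (subset_sum (carrier G))"
    using assms z\<^sub>1 by (intro poly_mapping_eqI) (simp add: lookup_sum of_nat_diff)
  also have "?P i = frag_cmul (int N - int w) (subset_sum (fam i j)) +
      frag_cmul ((int w - 1) * int z\<^sub>2) (subset_sum (carrier G))"
    using coset_union_mult_star[OF range_subset[of i] b_in[of i j], of "T i j"] assms T_props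
    unfolding card_range by (simp add: fam_def)
  also have "?P j = frag_cmul (int w * int z\<^sub>2) (subset_sum (carrier G)) -
      frag_cmul (int w) (subset_sum (fam i j))"
    using star_mult_coset_union[OF range_subset[of j] _ b_notin[of i j], of "T i j"] assms T_props
    unfolding card_range by (simp add: fam_def)
  finally show ?thesis
    by (rule trans) (intro poly_mapping_eqI, simp add: lookup_add lookup_minus algebra_simps)
qed

text \<open>The coefficients at a point outside the star, at a point of the star and at the identity
  are \<open>\<mu>\<close>, \<open>\<mu> + \<beta>\<close> and \<open>\<mu> + \<gamma>\<close>,
  which determine all three scalars. The first point must also differ from the identity.\<close>

lemma diag_coefficients_unique:
  assumes "i \<le> z\<^sub>1"
    and eq: "frag_cmul \<mu> (subset_sum (carrier G)) + frag_cmul \<beta> (subset_sum (fam i i)) +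
        frag_cmul \<gamma> (frag_of \<one>) =
      frag_cmul \<mu>' (subset_sum (carrier G)) + frag_cmul \<beta>' (subset_sum (fam i i)) +
        frag_cmul \<gamma>' (frag_of \<one>)"
  shows "\<mu> = \<mu>' \<and> \<beta> = \<beta>' \<and> \<gamma> = \<gamma>'"
proof -
  have lookup_eq: "Poly_Mapping.lookup (frag_cmul \<mu> (subset_sum (carrier G)) +
      frag_cmul \<beta> (subset_sum (fam i i)) + frag_cmul \<gamma> (frag_of \<one>)) x =
    Poly_Mapping.lookup (frag_cmul \<mu>' (subset_sum (carrier G)) +
      frag_cmul \<beta>' (subset_sum (fam i i)) + frag_cmul \<gamma>' (frag_of \<one>)) x" for x
    using eq by simp
  have coeff: "\<mu> + (if x \<in> fam i i then \<beta> else 0) + (if x = \<one> then \<gamma> else 0) =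
      \<mu>' + (if x \<in> fam i i then \<beta>' else 0) + (if x = \<one> then \<gamma>' else 0)"
    if "x \<in> carrier G" for x
    using lookup_eq[of x] that finite_fam[OF assms(1) assms(1)] finite_carrier
    by (auto simp: lookup_add lookup_subset_sum split: if_splits)
  have nontrivial: "\<exists>x\<in>L c. x \<noteq> \<one>" if "c \<le> q" for c
  proof (rule ccontr)
    assume "\<not> ?thesis"
    then have "L c \<subseteq> {\<one>}" by blast
    then have "card (L c) \<le> 1" using card_mono[of "{\<one>}"] by fastforce
    then show False using card_line[OF that] two_le by simp
  qed
  \<comment> \<open>Any second index above \<open>i\<close> selects the left end of the interval;
    \<open>b_le\<close> does not restrict that index.\<close>
  have "\<kappa> i \<le> q" using b_le[of i "Suc i"] assms(1) by (simp add: b_def)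
  then obtain x where x: "x \<in> L (\<kappa> i)" "x \<noteq> \<one>" using nontrivial by blast
  have x_in: "x \<in> fam i i" using x w by (auto simp: fam_def)
  \<comment> \<open>There are \<open>q + 1\<close> lines and the star uses only
    \<open>w \<le> q\<close> of them.\<close>
  obtain d where d: "d \<le> q" "d \<notin> {\<kappa> i..w + \<kappa> i - 1}"
  proof -
    have "card {\<kappa> i..w + \<kappa> i - 1} < card {..q}" using w by simp
    then have "\<not> {..q} \<subseteq> {\<kappa> i..w + \<kappa> i - 1}" by (meson card_mono finite_atLeastAtMost leD)
    then show ?thesis using that by blast
  qed
  obtain y where y: "y \<in> L d" "y \<noteq> \<one>" using nontrivial d by blast
  have y_notin: "y \<notin> fam i i"
  proof
    assume "y \<in> fam i i"
    then obtain c where "c \<in> {\<kappa> i..w + \<kappa> i - 1}" "y \<in> L c"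
      by (auto simp: fam_def)
    then show False
      using d y line_inter[of d c] range_subset[OF assms(1)] by blast
  qed
  have "y \<in> carrier G" "x \<in> carrier G"
    using y line_subset[OF d(1)] x_in fam_subset assms by auto
  then show ?thesis
    using coeff[of y] coeff[of x] coeff[of \<one>] x x_in y y_notin by (auto simp: fam_def)
qed

text \<open>The equation at \<open>(0, 0)\<close> already fixes \<open>\<mu>\<close>,
  \<open>l\<close> and \<open>t\<close>, and the one at \<open>(0, 1)\<close> then becomes the
  condition on \<open>z\<^sub>2\<close>. Conversely, under that condition the two sum formulas
  verify all equations at once. Writing \<open>z\<^sub>2 + 1 = w\<close> avoids truncated
  subtraction.\<close>

lemma partial_sum_family_iff:
  "partial_sum_family_with G fam (z\<^sub>1 + 1) n k l \<mu> t \<longleftrightarrow>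
     (z\<^sub>2 = w \<or> z\<^sub>2 + 1 = w) \<and>
     n = N * N \<and> k = (N - 1) * w + z\<^sub>1 * z\<^sub>2 * N \<and>
     l = int N + (int w)\<^sup>2 - 3 * int w + int z\<^sub>1 * (int z\<^sub>2)\<^sup>2 \<and>
     \<mu> = (int w)\<^sup>2 - int w + int z\<^sub>1 * (int z\<^sub>2)\<^sup>2 \<and>
     t = int N * int w - int w + int z\<^sub>1 * (int z\<^sub>2)\<^sup>2" (is "?lhs \<longleftrightarrow> ?rhs")
proof -
  define m where "m = (int w)\<^sup>2 - int w + int z\<^sub>1 * (int z\<^sub>2)\<^sup>2"
  have card_sum: "(\<Sum>j<z\<^sub>1 + 1. card (fam i j)) = (N - 1) * w + z\<^sub>1 * z\<^sub>2 * N"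
    "(\<Sum>j<z\<^sub>1 + 1. card (fam j i)) = (N - 1) * w + z\<^sub>1 * z\<^sub>2 * N" if "i \<le> z\<^sub>1" for i
  proof -
    have "(\<Sum>j<z\<^sub>1 + 1. if i = j then (N - 1) * w else z\<^sub>2 * N) =
        (N - 1) * w + (\<Sum>j\<in>{..<z\<^sub>1 + 1} - {i}. if i = j then (N - 1) * w else z\<^sub>2 * N)"
      using that by (subst sum.remove[of _ i]) auto
    also have "(\<Sum>j\<in>{..<z\<^sub>1 + 1} - {i}. if i = j then (N - 1) * w else z\<^sub>2 * N) =
        (\<Sum>j\<in>{..<z\<^sub>1 + 1} - {i}. z\<^sub>2 * N)"
      by (intro sum.cong) auto
    also have "\<dots> = z\<^sub>1 * z\<^sub>2 * N" using that by simp
    finally have "(\<Sum>j<z\<^sub>1 + 1. if i = j then (N - 1) * w else z\<^sub>2 * N) =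
        (N - 1) * w + z\<^sub>1 * z\<^sub>2 * N" .
    moreover have "(\<Sum>j<z\<^sub>1 + 1. card (fam i j)) =
        (\<Sum>j<z\<^sub>1 + 1. if i = j then (N - 1) * w else z\<^sub>2 * N)"
      "(\<Sum>j<z\<^sub>1 + 1. card (fam j i)) = (\<Sum>j<z\<^sub>1 + 1. if i = j then (N - 1) * w else z\<^sub>2 * N)"
      using that by (auto simp: card_fam intro!: sum.cong)
    ultimately show "(\<Sum>j<z\<^sub>1 + 1. card (fam i j)) = (N - 1) * w + z\<^sub>1 * z\<^sub>2 * N"
      "(\<Sum>j<z\<^sub>1 + 1. card (fam j i)) = (N - 1) * w + z\<^sub>1 * z\<^sub>2 * N"
      by simp_all
  qed
  have quadratic: "(2 * int w - 1) * int z\<^sub>2 + (int z\<^sub>1 - 1) * (int z\<^sub>2)\<^sup>2 = m \<longleftrightarrow>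
      z\<^sub>2 = w \<or> z\<^sub>2 + 1 = w"
  proof -
    \<comment> \<open>The terms with \<open>z\<^sub>1\<close> cancel in the difference of the two
      sides, so the condition depends on \<open>w\<close> and \<open>z\<^sub>2\<close> only.\<close>
    have "(2 * int w - 1) * int z\<^sub>2 + (int z\<^sub>1 - 1) * (int z\<^sub>2)\<^sup>2 = m \<longleftrightarrow>
        (int z\<^sub>2 - int w) * (int z\<^sub>2 + 1 - int w) = 0"
      unfolding m_def by (auto simp: algebra_simps power2_eq_square)
    then show ?thesis by auto
  qed
  \<comment> \<open>Both sides carry the same multiple of \<open>fam i j\<close>. After cancelling
    it, two multiples of the nonzero element \<open>subset_sum (carrier G)\<close> remain to be
    compared.\<close>
  have off_iff: "frag_cmul ((2 * int w - 1) * int z\<^sub>2 + (int z\<^sub>1 - 1) * (int z\<^sub>2)\<^sup>2)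
        (subset_sum (carrier G)) + frag_cmul (int N - 2 * int w) (subset_sum (fam i j)) =
      frag_cmul m (subset_sum (carrier G)) + frag_cmul (int N - 2 * int w) (subset_sum (fam i j))
      \<longleftrightarrow> z\<^sub>2 = w \<or> z\<^sub>2 + 1 = w" for i j
  proof -
    have "subset_sum (carrier G) \<noteq> 0"
      using lookup_subset_sum[OF finite_carrier, of \<one>] by auto
    then show ?thesis
      using quadratic frag_cmul_diff_distrib[of _ m "subset_sum (carrier G)"]
      by (metis add_right_cancel diff_self eq_iff_diff_eq_0 frag_cmul_eq_0_iff)
  qed
  show ?thesis
  proof
    assume fam: ?lhs
    have eqn: "(\<Sum>h<z\<^sub>1 + 1. subset_sum (fam h j) \<star> subset_sum (fam i h)) =
          frag_cmul \<mu> (subset_sum (carrier G)) + frag_cmul (l - \<mu>) (subset_sum (fam i j))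
            + (if i = j then frag_cmul (t - \<mu>) (frag_of \<one>) else 0)"
      if "i \<le> z\<^sub>1" "j \<le> z\<^sub>1" for i j
      using fam that unfolding partial_sum_family_with_def by simp
    have params: "m = \<mu> \<and> int N - 2 * int w = l - \<mu> \<and> int N * int w - (int w)\<^sup>2 = t - \<mu>"
      using eqn[of 0 0] unfolding sum_products_diag[OF le0] m_def[symmetric]
      by (intro diag_coefficients_unique[of 0]) simp_all
    have "z\<^sub>2 = w \<or> z\<^sub>2 + 1 = w"
      using eqn[of 0 1, unfolded sum_products_off[OF le0 z\<^sub>1 zero_neq_one]] off_iff[of 0 1] z\<^sub>1 params
      by simp
    moreover have "n = N * N" "k = (N - 1) * w + z\<^sub>1 * z\<^sub>2 * N"
      using fam order_eq card_sum(1)[of 0] unfolding partial_sum_family_with_def by auto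
    ultimately show ?rhs
      using params unfolding m_def by (auto simp: power2_eq_square)
  next
    assume r: ?rhs
    then have params: "m = \<mu>" "l - \<mu> = int N - 2 * int w" "t - \<mu> = int N * int w - (int w)\<^sup>2"
      by (simp_all add: m_def)
    have eqn: "(\<Sum>h<z\<^sub>1 + 1. subset_sum (fam h j) \<star> subset_sum (fam i h)) =
          frag_cmul \<mu> (subset_sum (carrier G)) + frag_cmul (l - \<mu>) (subset_sum (fam i j))
            + (if i = j then frag_cmul (t - \<mu>) (frag_of \<one>) else 0)"
      if "i \<le> z\<^sub>1" "j \<le> z\<^sub>1" for i j
    proof (cases "i = j")
      case True
      \<comment> \<open>The differences \<open>l - \<mu>\<close> and \<open>t - \<mu>\<close> are
        rewritten first, because replacing \<open>\<mu>\<close> would destroy these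
        patterns.\<close>
      show ?thesis
        using sum_products_diag[OF that(1)]
        unfolding params(2,3) unfolding params(1)[symmetric] m_def True by (simp only: refl if_True)
    next
      case False
      show ?thesis
        unfolding params(2,3) unfolding params(1)[symmetric] sum_products_off[OF that False] if_not_P[OF False]
          add_0_right
        using off_iff r by blast
    qed
    show ?lhs
      unfolding partial_sum_family_with_def
    proof (intro conjI allI impI)
      show "\<one> \<notin> fam i i" for i by (simp add: fam_def)
    qed (use r card_sum eqn fam_subset finite_carrier order_eq comm_group_axioms in simp_all)
  qed
qed

end

section \<open>Chain rings and their lines\<close>

context cring
begin

lemma cgenideal_one: "PIdl \<one> = carrier R"
  unfolding cgenideal_def by force

text \<open>A product of ideals is generated by the elementwise product, which for principal ideals
  is already principal and hence an ideal. This turns the hypotheses on powers of \<open>I\<close>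
  into statements about powers of its generator.\<close>

lemma ideal_power_cgenideal:
  assumes "x \<in> carrier R"
  shows "ideal_power R (PIdl x) n = PIdl (x [^] n)"
proof (induction n)
  case 0
  then show ?case
    by (simp add: ideal_power_def ideals_set_def cgenideal_one)
next
  case (Suc n)
  have carr: "x [^] n \<in> carrier R" using assms by simp
  have "ideal_power R (PIdl x) (Suc n) = (PIdl (x [^] n)) \<cdot> (PIdl x)"
    using Suc by (simp add: ideal_power_def ideals_set_def)
  also have "\<dots> = Idl (PIdl (x [^] Suc n))"
    using ideal_prod_eq_genideal[OF cgenideal_ideal[OF carr] cgenideal_ideal[OF assms]]
      cgenideal_prod[OF carr assms] by simp
  also have "\<dots> = PIdl (x [^] Suc n)"
    using cgenideal_ideal[OF nat_pow_closed[OF assms, of "Suc n"]]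
    by (meson equalityI genideal_minimal genideal_self ideal.Icarr order_refl subsetI)
  finally show ?case .
qed

lemma cgenideal_eq_zero_iff:
  assumes "x \<in> carrier R"
  shows "PIdl x = {\<zero>} \<longleftrightarrow> x = \<zero>"
proof
  show "PIdl x = {\<zero>} \<Longrightarrow> x = \<zero>" using cgenideal_self[OF assms] by blast
  show "x = \<zero> \<Longrightarrow> PIdl x = {\<zero>}" by (force simp: cgenideal_def)
qed

end

section \<open>Regular elements outside a maximal ideal with nilpotent generator\<close>

locale nilpotent_maximal = cring R for R :: "('a, 'b) ring_scheme" (structure) +
  fixes \<pi> :: 'a and s :: nat
  assumes \<pi>_closed: "\<pi> \<in> carrier R"
    and maximal: "maximalideal (PIdl \<pi>) R"
    and nilpotent: "\<pi> [^] s = \<zero>"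
begin

text \<open>Since \<open>x\<close> is invertible modulo \<open>\<pi>\<close>, the relation \<open>x \<otimes> y = \<zero>\<close> gives
  \<open>y = \<pi> \<otimes> c \<otimes> y\<close> for some \<open>c\<close>, and iterating this kills \<open>y\<close>.\<close>

lemma regular:
  assumes x: "x \<in> carrier R" "x \<notin> PIdl \<pi>" and y: "y \<in> carrier R" and xy: "x \<otimes> y = \<zero>"
  shows "y = \<zero>"
proof -
  interpret M: maximalideal "PIdl \<pi>" R by (rule maximal)
  have "ideal (PIdl \<pi> <+> PIdl x) R"
    using cgenideal_ideal \<pi>_closed x(1) by (intro add_ideals)
  moreover have "PIdl \<pi> \<subseteq> PIdl \<pi> <+> PIdl x"
  proof
    fix u assume u: "u \<in> PIdl \<pi>"
    then have "u = u \<oplus> \<zero>" using M.Icarr by simp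
    moreover have "\<zero> \<in> PIdl x"
      using cgenideal_ideal[OF x(1)] by (simp add: additive_subgroup.zero_closed ideal.axioms(1))
    ultimately show "u \<in> PIdl \<pi> <+> PIdl x" using u unfolding set_add_def' by blast
  qed
  moreover have "x \<in> PIdl \<pi> <+> PIdl x"
  proof -
    have "x = \<zero> \<oplus> x" using x(1) by simp
    then show ?thesis
      using M.zero_closed cgenideal_self[OF x(1)] unfolding set_add_def' by blast
  qed
  ultimately have "PIdl \<pi> <+> PIdl x = carrier R"
    using M.I_maximal x ideal.Icarr by (metis subsetI)
  then have "\<one> \<in> PIdl \<pi> <+> PIdl x" by simp
  then obtain c r where cr: "c \<in> carrier R" "r \<in> carrier R" "\<one> = c \<otimes> \<pi> \<oplus> r \<otimes> x"
    unfolding set_add_def' cgenideal_def by auto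
  have "y = (c \<otimes> \<pi> \<oplus> r \<otimes> x) \<otimes> y" using l_one[OF y] cr(3) by simp
  also have "\<dots> = c \<otimes> \<pi> \<otimes> y \<oplus> r \<otimes> (x \<otimes> y)"
    using cr(1,2) x y \<pi>_closed by (simp add: l_distr m_assoc)
  finally have step: "y = c \<otimes> \<pi> \<otimes> y" using cr(1,2) xy y \<pi>_closed by simp
  have "\<exists>z\<in>carrier R. y = \<pi> [^] n \<otimes> z" for n :: nat
  proof (induction n)
    case 0
    then show ?case using y by simp
  next
    case (Suc n)
    then obtain z where z: "z \<in> carrier R" "y = \<pi> [^] n \<otimes> z" by blast
    have "y = c \<otimes> \<pi> \<otimes> (\<pi> [^] n \<otimes> z)" using step z(2) by simp
    also have "\<dots> = \<pi> [^] Suc n \<otimes> (c \<otimes> z)"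
      using z(1) cr(1) \<pi>_closed by (simp add: m_ac)
    finally show ?case using z(1) cr(1) by blast
  qed
  then obtain z where "z \<in> carrier R" "y = \<pi> [^] s \<otimes> z" by blast
  then show ?thesis using nilpotent by simp
qed

end

section \<open>Coset representatives and the order of the ring\<close>

lemma (in ring) coset_representatives_bij:
  assumes "ideal I R" "coset_representatives R I J"
  shows "bij_betw (\<lambda>a. I +> a) J (carrier (R Quot I))"
proof -
  interpret ideal I R by (rule assms(1))
  have carr: "carrier (R Quot I) = (\<lambda>a. I +> a) ` carrier R"
    by (auto simp: FactRing_def A_RCOSETS_def' )
  have J: "J \<subseteq> carrier R" "\<And>C. C \<in> carrier (R Quot I) \<Longrightarrow> \<exists>!a. a \<in> J \<inter> C"
    using assms(2) by (auto simp: coset_representatives_def)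
  have self: "a \<in> I +> a" if "a \<in> carrier R" for a
    using that a_rcos_self by blast
  have "inj_on (\<lambda>a. I +> a) J"
  proof (rule inj_onI)
    fix a b assume ab: "a \<in> J" "b \<in> J" "I +> a = I +> b"
    then have "a \<in> J \<inter> (I +> a)" "b \<in> J \<inter> (I +> a)"
      using self J(1) by auto
    moreover have "I +> a \<in> carrier (R Quot I)" using carr ab(1) J(1) by auto
    ultimately show "a = b" using J(2) by blast
  qed
  moreover have "(\<lambda>a. I +> a) ` J = carrier (R Quot I)"
  proof
    show "(\<lambda>a. I +> a) ` J \<subseteq> carrier (R Quot I)" using carr J(1) by auto
    show "carrier (R Quot I) \<subseteq> (\<lambda>a. I +> a) ` J"
    proof
      fix C assume C: "C \<in> carrier (R Quot I)"
      then obtain a where a: "a \<in> J" "a \<in> C" using J(2) by blast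
      obtain c where "c \<in> carrier R" "C = I +> c" using C carr by auto
      then have "C = I +> a" using a(2) a_repr_independence[OF _ _ a_subgroup] by blast
      then show "C \<in> (\<lambda>a. I +> a) ` J" using a(1) by blast
    qed
  qed
  ultimately show ?thesis by (simp add: bij_betw_def)
qed

text \<open>Together with \<open>regular\<close>, this makes the difference of two distinct finite
  slopes a non-zero-divisor.\<close>

lemma (in ring) coset_representatives_diff_notin:
  assumes "ideal I R" "coset_representatives R I J" "a \<in> J" "b \<in> J" "a \<noteq> b"
  shows "a \<ominus> b \<notin> I"
proof -
  have "a \<in> carrier R" "b \<in> carrier R"
    using assms by (auto simp: coset_representatives_def)
  then show ?thesis
    using quotient_eq_iff_same_a_r_cos[OF assms(1)]
      coset_representatives_bij[OF assms(1,2)] assms(3-5)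
    by (auto simp: bij_betw_def dest: inj_onD)
qed

context nilpotent_maximal
begin

lemma ideal_\<pi>: "ideal (PIdl \<pi>) R"
  using cgenideal_ideal \<pi>_closed by blast

text \<open>One step of the \<pi>-adic expansion: an element of the ideal of
  \<open>\<pi> [^] i\<close> has a unique leading digit in \<open>J\<close> and a remainder in the
  next ideal. Two different digits would produce an element outside the maximal ideal that
  annihilates \<open>\<pi> [^] i\<close>, against regularity.\<close>

lemma card_cgenideal_power_step:
  assumes J: "coset_representatives R (PIdl \<pi>) J" and i: "\<pi> [^] (i::nat) \<noteq> \<zero>"
  shows "card (PIdl (\<pi> [^] i)) = card J * card (PIdl (\<pi> [^] Suc i))"
proof -
  let ?f = "\<lambda>(a, y). a \<otimes> \<pi> [^] i \<oplus> y"
  have pc: "\<pi> [^] i \<in> carrier R" "\<pi> [^] Suc i \<in> carrier R" using \<pi>_closed by auto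
  have Jc: "J \<subseteq> carrier R" using J by (simp add: coset_representatives_def)
  have "inj_on ?f (J \<times> (PIdl (\<pi> [^] Suc i)))"
  proof (rule inj_onI, clarify)
    fix a y b z
    assume *: "a \<in> J" "b \<in> J" "y \<in> PIdl (\<pi> [^] Suc i)" "z \<in> PIdl (\<pi> [^] Suc i)"
      and eq: "a \<otimes> \<pi> [^] i \<oplus> y = b \<otimes> \<pi> [^] i \<oplus> z"
    obtain u v where uv: "u \<in> carrier R" "v \<in> carrier R"
      "y = u \<otimes> \<pi> [^] Suc i" "z = v \<otimes> \<pi> [^] Suc i"
      using *(3,4) by (auto simp: cgenideal_def)
    have ab: "a \<in> carrier R" "b \<in> carrier R" using *(1,2) Jc by auto
    have "a = b"
    proof (rule ccontr)
      assume "a \<noteq> b"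
      then have notin: "a \<ominus> b \<notin> PIdl \<pi>"
        using coset_representatives_diff_notin[OF ideal_\<pi> J] *(1,2) by blast
      \<comment> \<open>Chosen so that \<open>?w \<otimes> \<pi> [^] i\<close> is the difference of
        the remainders \<open>y\<close> and \<open>z\<close>. Being in the maximal ideal, it cannot
        move \<open>a \<ominus> b\<close> into that ideal.\<close>
      let ?w = "(u \<ominus> v) \<otimes> \<pi>"
      have w: "?w \<in> PIdl \<pi>" using uv by (auto simp: cgenideal_def)
      have "a \<ominus> b \<oplus> ?w \<notin> PIdl \<pi>"
      proof
        assume "a \<ominus> b \<oplus> ?w \<in> PIdl \<pi>"
        then have "a \<ominus> b \<oplus> ?w \<oplus> \<ominus> ?w \<in> PIdl \<pi>"
          using w additive_subgroup.a_closed additive_subgroup.a_inv_closed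
            ideal.axioms(1)[OF ideal_\<pi>] by metis
        then show False using notin ab uv \<pi>_closed by (simp add: a_assoc r_neg)
      qed
      moreover have "(a \<ominus> b \<oplus> ?w) \<otimes> \<pi> [^] i =
          (a \<otimes> \<pi> [^] i \<oplus> y) \<ominus> (b \<otimes> \<pi> [^] i \<oplus> z)"
        unfolding uv(3,4) nat_pow_Suc using ab uv(1,2) \<pi>_closed pc(1) by algebra
      then have "(a \<ominus> b \<oplus> ?w) \<otimes> \<pi> [^] i = \<zero>"
        unfolding eq using ab uv \<pi>_closed by (simp add: r_right_minus_eq)
      ultimately show False
        using regular[of "a \<ominus> b \<oplus> ?w" "\<pi> [^] i"] ab uv \<pi>_closed i by simp
    qed
    moreover then have "y = z" using eq ab uv pc by simp
    ultimately show "a = b \<and> y = z" by simp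
  qed
  moreover have "?f ` (J \<times> (PIdl (\<pi> [^] Suc i))) = PIdl (\<pi> [^] i)"
  proof (intro equalityI subsetI)
    fix x assume "x \<in> ?f ` (J \<times> (PIdl (\<pi> [^] Suc i)))"
    then obtain a u where au: "a \<in> carrier R" "u \<in> carrier R"
      "x = a \<otimes> \<pi> [^] i \<oplus> u \<otimes> \<pi> [^] Suc i"
      using Jc by (auto simp: cgenideal_def)
    then have "x = (a \<oplus> u \<otimes> \<pi>) \<otimes> \<pi> [^] i"
      using \<pi>_closed pc(1) unfolding nat_pow_Suc by algebra
    then show "x \<in> PIdl (\<pi> [^] i)" using au \<pi>_closed by (auto simp: cgenideal_def)
  next
    fix x assume "x \<in> PIdl (\<pi> [^] i)"
    then obtain r where r: "r \<in> carrier R" "x = r \<otimes> \<pi> [^] i" by (auto simp: cgenideal_def)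
    \<comment> \<open>The leading digit is the representative of the coset of the cofactor
      \<open>r\<close>.\<close>
    have "(PIdl \<pi>) +> r \<in> carrier (R Quot (PIdl \<pi>))"
      using r by (auto simp: FactRing_def A_RCOSETS_def')
    then obtain a where a: "a \<in> J" "(PIdl \<pi>) +> r = (PIdl \<pi>) +> a"
      using coset_representatives_bij[OF ideal_\<pi> J] by (auto simp: bij_betw_def)
    then have "r \<ominus> a \<in> PIdl \<pi>"
      using quotient_eq_iff_same_a_r_cos[OF ideal_\<pi> r(1)] Jc by blast
    then obtain u where u: "u \<in> carrier R" "r \<ominus> a = u \<otimes> \<pi>" by (auto simp: cgenideal_def)
    have ac: "a \<in> carrier R" using a Jc by blast
    have "r = a \<oplus> (r \<ominus> a)" using ac r(1) by algebra
    then have "x = (a \<oplus> u \<otimes> \<pi>) \<otimes> \<pi> [^] i" using r(2) u(2) by simp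
    also have "\<dots> = a \<otimes> \<pi> [^] i \<oplus> u \<otimes> \<pi> [^] Suc i"
      unfolding nat_pow_Suc using ac u(1) \<pi>_closed pc(1) by algebra
    finally show "x \<in> ?f ` (J \<times> (PIdl (\<pi> [^] Suc i)))"
      using a(1) u(1) by (force simp: cgenideal_def)
  qed
  ultimately have "card (PIdl (\<pi> [^] i)) = card (J \<times> (PIdl (\<pi> [^] Suc i)))"
    by (metis card_image)
  then show ?thesis by (simp add: card_cartesian_product)
qed

text \<open>The descending chain of ideals starts at \<open>PIdl \<one>\<close>, the whole ring, and
  reaches the zero ideal after \<open>s\<close> steps. Each step divides the cardinality by
  \<open>card J\<close>, since no power before the last vanishes.\<close>

lemma card_carrier:
  assumes J: "coset_representatives R (PIdl \<pi>) J" and nonzero: "\<pi> [^] (s - 1) \<noteq> \<zero>"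
  shows "card (carrier R) = card J ^ s"
proof -
  have step: "\<pi> [^] i \<noteq> \<zero>" if "i < s" for i
  proof
    assume "\<pi> [^] i = \<zero>"
    moreover have "\<pi> [^] (s - 1) = \<pi> [^] i \<otimes> \<pi> [^] (s - 1 - i)"
      using that \<pi>_closed by (simp add: nat_pow_mult)
    ultimately show False using nonzero \<pi>_closed by simp
  qed
  have "card (PIdl \<one>) = card J ^ i * card (PIdl (\<pi> [^] i))" if "i \<le> s" for i
    using that
  proof (induction i)
    case (Suc i)
    then show ?case using card_cgenideal_power_step[OF J step[of i]] by simp
  qed simp
  from this[of s] have "card (PIdl \<one>) = card J ^ s"
    using cgenideal_eq_zero_iff[of \<zero>] by (simp add: nilpotent)
  then show ?thesis by (simp add: cgenideal_one)
qed

end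

section \<open>Lines as subgroups of the plane\<close>

context cring
begin

lemma comm_group_plane: "comm_group (plane_group R)"
proof (rule group.group_comm_groupI)
  show "group (plane_group R)"
    by (intro DirProd_group add.is_group)
qed (auto simp: a_comm)

lemma subgroup_line:
  assumes "\<And>a. c = Some a \<Longrightarrow> a \<in> carrier R"
  shows "subgroup (line R c) (plane_group R)"
proof -
  interpret P: comm_group "plane_group R" by (rule comm_group_plane)
  have inv: "inv\<^bsub>plane_group R\<^esub> (x, y) = (\<ominus> x, \<ominus> y)" if "x \<in> carrier R" "y \<in> carrier R" for x y
    using that by (simp add: add.is_group a_inv_def)
  show ?thesis
  proof (cases c)
    case None
    show ?thesis
      unfolding None
    proof (rule P.subgroupI)
      fix g assume "g \<in> line R None"
      then show "inv\<^bsub>plane_group R\<^esub> g \<in> line R None" by (auto simp: inv)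
    qed auto
  next
    case (Some a)
    then have a: "a \<in> carrier R" using assms by simp
    show ?thesis
      unfolding Some
    proof (rule P.subgroupI)
      fix g assume "g \<in> line R (Some a)"
      then show "inv\<^bsub>plane_group R\<^esub> g \<in> line R (Some a)"
        using a by (auto simp: inv r_minus simp flip: a_inv_def)
    next
      fix g h assume "g \<in> line R (Some a)" "h \<in> line R (Some a)"
      then show "g \<otimes>\<^bsub>plane_group R\<^esub> h \<in> line R (Some a)"
        using a by (auto simp: r_distr[symmetric])
    qed (use a in auto)
  qed
qed

lemma card_line: "card (line R c) = card (carrier R)"
proof (cases c)
  case None
  have "line R None = (\<lambda>x. (\<zero>, x)) ` carrier R" by auto
  then show ?thesis using None by (simp add: card_image inj_on_def)
next
  case (Some a)
  have "line R (Some a) = (\<lambda>x. (x, a \<otimes> x)) ` carrier R" by auto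
  then show ?thesis using Some by (simp add: card_image inj_on_def)
qed

end

context nilpotent_maximal
begin

text \<open>A common point of the lines with slopes \<open>a\<close> and \<open>b\<close> satisfies
  \<open>(a \<ominus> b) \<otimes> x = \<zero>\<close>, and \<open>a \<ominus> b\<close> is regular.
  On the vertical line the first coordinate is zero, which forces the second to vanish on any other
  line.\<close>

lemma line_inter:
  assumes J: "coset_representatives R (PIdl \<pi>) J"
    and "c \<in> insert None (Some ` J)" "e \<in> insert None (Some ` J)" "c \<noteq> e"
  shows "line R c \<inter> line R e = {\<one>\<^bsub>plane_group R\<^esub>}"
proof -
  have Jc: "J \<subseteq> carrier R" using J by (simp add: coset_representatives_def)
  have None_Some: "line R None \<inter> line R (Some a) = {(\<zero>, \<zero>)}" if "a \<in> J" for a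
    using that Jc by (auto simp: subset_iff)
  have Some_Some: "line R (Some a) \<inter> line R (Some b) = {(\<zero>, \<zero>)}"
    if ab: "a \<in> J" "b \<in> J" "a \<noteq> b" for a b
  proof -
    have carr: "a \<in> carrier R" "b \<in> carrier R" using ab Jc by auto
    have "x = \<zero>" if x: "x \<in> carrier R" "a \<otimes> x = b \<otimes> x" for x
    proof (rule regular)
      show "a \<ominus> b \<notin> PIdl \<pi>"
        using coset_representatives_diff_notin[OF ideal_\<pi> J ab] .
      have "(a \<ominus> b) \<otimes> x = a \<otimes> x \<ominus> b \<otimes> x" using carr x(1) by algebra
      then show "(a \<ominus> b) \<otimes> x = \<zero>" using carr x by (simp add: r_right_minus_eq)
    qed (use carr x in auto)
    then show ?thesis using carr by fastforce
  qed
  show ?thesis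
    using assms(2-4)
    by (cases c; cases e)
      (simp_all add: None_Some Some_Some Int_commute[of _ "line R None"] image_iff del: line.simps)
qed

text \<open>The labelling is injective on \<open>{0..q}\<close>, so distinct positions carry
  distinct slopes and the lines can be indexed by position.\<close>

lemma line_net_plane:
  assumes "finite (carrier R)" "\<one> \<noteq> \<zero>"
    and J: "coset_representatives R (PIdl \<pi>) J" and a: "slope_labelling J q a"
  shows "line_net (plane_group R) (card (carrier R)) q (\<lambda>i. line R (a i))"
proof -
  interpret P: comm_group "plane_group R" by (rule comm_group_plane)
  have a_in: "a i \<in> insert None (Some ` J)" if "i \<le> q" for i
    using a that unfolding slope_labelling_def by (meson atLeastAtMost_iff bij_betwE zero_le)
  have a_inj: "a i \<noteq> a j" if "i \<le> q" "j \<le> q" "i \<noteq> j" for i j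
    using a that unfolding slope_labelling_def bij_betw_def inj_on_def by auto
  have "card {\<zero>, \<one>} \<le> card (carrier R)" using assms(1) by (intro card_mono) auto
  then have "2 \<le> card (carrier R)" using assms(2) by simp
  moreover have "subgroup (line R (a i)) (plane_group R)" if "i \<le> q" for i
    using a_in[OF that] J by (intro subgroup_line) (auto simp: coset_representatives_def)
  ultimately show ?thesis
    using assms(1) a_in a_inj
    by (intro line_net.intro P.comm_group_axioms line_net_axioms.intro)
      (simp_all add: order_def card_cartesian_product card_line line_inter[OF J] del: line.simps)
qed

end

text \<open>The given family is known only on the index range, and every sum in the definition stays
  inside that range.\<close>

lemma partial_sum_family_with_cong:
  assumes "\<And>i j. i < m \<Longrightarrow> j < m \<Longrightarrow> S i j = S' i j"
  shows "partial_sum_family_with G S m n k l \<mu> t = partial_sum_family_with G S' m n k l \<mu> t"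
proof -
  have "(\<Sum>h<m. group_ring_mult G (subset_sum (S h j)) (subset_sum (S i h))) =
      (\<Sum>h<m. group_ring_mult G (subset_sum (S' h j)) (subset_sum (S' i h)))"
    "(\<Sum>j<m. card (S i j)) = (\<Sum>j<m. card (S' i j))"
    "(\<Sum>j<m. card (S j i)) = (\<Sum>j<m. card (S' j i))" if "i < m" "j < m" for i j
    using assms that by (auto intro!: sum.cong)
  then show ?thesis
    unfolding partial_sum_family_with_def using assms by (simp cong: conj_cong)
qed

theorem lemma3p2:
  fixes R :: "('a, 'b) ring_scheme"
    and I J :: "'a set"
    and \<pi> :: 'a
    and p s d r w z\<^sub>1 z\<^sub>2 :: nat
    and a :: "nat \<Rightarrow> 'a option"
    and \<kappa> :: "nat \<Rightarrow> nat"
    and T S :: "nat \<Rightarrow> nat \<Rightarrow> ('a \<times> 'a) set"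
  assumes "Factorial_Ring.prime p" "s > 0" "d > 0" "r > 0" "r \<le> s"
    and "finite_chain_ring R"
    and "maximalideal I R" "\<pi> \<in> carrier R" "I = Idl\<^bsub>R\<^esub> {\<pi>}"
    and "ideal_power R I (s - 1) \<noteq> {\<zero>\<^bsub>R\<^esub>}" "ideal_power R I s = {\<zero>\<^bsub>R\<^esub>}"
    and "([p] \<cdot>\<^bsub>R\<^esub> \<one>\<^bsub>R\<^esub>) \<sim>\<^bsub>R\<^esub> (\<pi> [^]\<^bsub>R\<^esub> r)"
    and "field (R Quot I)" "order (R Quot I) = p ^ d"
    and "1 \<le> w" "w \<le> p ^ d"
    and "1 \<le> z\<^sub>1" "z\<^sub>1 \<le> p ^ d - w + 1"
    and "1 \<le> z\<^sub>2" "z\<^sub>2 \<le> p ^ (s * d)"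
    and "coset_representatives R I J"
    and "slope_labelling J (p ^ d) a"
    and "strict_mono_on {0..z\<^sub>1} \<kappa>" "\<And>i. i \<le> z\<^sub>1 \<Longrightarrow> \<kappa> i \<le> p ^ d - w + 1"
    and "\<And>i j. i \<le> z\<^sub>1 \<Longrightarrow> j \<le> z\<^sub>1 \<Longrightarrow> i \<noteq> j \<Longrightarrow> card (T i j) = z\<^sub>2"
    and "\<And>i j. i \<le> z\<^sub>1 \<Longrightarrow> j \<le> z\<^sub>1 \<Longrightarrow> i \<noteq> j \<Longrightarrow>
           in_distinct_cosets (plane_group R) (line R (off_slope a w \<kappa> i j)) (T i j)"
    and "\<And>i j. i \<le> z\<^sub>1 \<Longrightarrow> j \<le> z\<^sub>1 \<Longrightarrow> S i j = constructed_family R a w \<kappa> T i j"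
  shows "(is_partial_sum_family (plane_group R) (z\<^sub>1 + 1) S \<longleftrightarrow>
            (2 \<le> w \<longrightarrow> z\<^sub>2 \<in> {w - 1, w}) \<and> (w = 1 \<longrightarrow> z\<^sub>2 = 1)) \<and>
         (is_partial_sum_family (plane_group R) (z\<^sub>1 + 1) S \<longrightarrow>
            (\<forall>n k l \<mu> t. partial_sum_family_with (plane_group R) S (z\<^sub>1 + 1) n k l \<mu> t \<longleftrightarrow>
               (n, k, l, \<mu>, t) =
                 (p ^ (2 * s * d),
                  (p ^ (s * d) - 1) * w + z\<^sub>1 * z\<^sub>2 * p ^ (s * d),
                  int p ^ (s * d) + (int w)\<^sup>2 - 3 * int w + int z\<^sub>1 * (int z\<^sub>2)\<^sup>2,
                  (int w)\<^sup>2 - int w + int z\<^sub>1 * (int z\<^sub>2)\<^sup>2,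
                  int p ^ (s * d) * int w - int w + int z\<^sub>1 * (int z\<^sub>2)\<^sup>2)))"
proof -
  have R: "cring R" "finite (carrier R)"
    using assms(6) by (auto simp: finite_chain_ring_def)
  interpret cring R by (rule R(1))
  have I: "I = PIdl\<^bsub>R\<^esub> \<pi>"
    using cgenideal_eq_genideal[OF assms(8)] assms(9) by simp
  have nonzero: "\<pi> [^]\<^bsub>R\<^esub> (s - 1) \<noteq> \<zero>\<^bsub>R\<^esub>"
    using assms(10) cgenideal_eq_zero_iff[of "\<pi> [^]\<^bsub>R\<^esub> (s - 1)"] assms(8)
    unfolding I ideal_power_cgenideal[OF assms(8)] by simp
  have "\<pi> [^]\<^bsub>R\<^esub> s = \<zero>\<^bsub>R\<^esub>"
    using assms(11) cgenideal_eq_zero_iff[of "\<pi> [^]\<^bsub>R\<^esub> s"] assms(8)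
    unfolding I ideal_power_cgenideal[OF assms(8)] by simp
  then interpret nilpotent_maximal R \<pi> s
    using assms(7,8) unfolding I
    by (intro nilpotent_maximal.intro nilpotent_maximal_axioms.intro R(1))
  note J = assms(21)[unfolded I]
  define N where "N = card (carrier R)"
  have "card J = p ^ d"
    using bij_betw_same_card[OF coset_representatives_bij[OF ideal_\<pi> J]] assms(14)
    by (simp add: I order_def)
  then have N: "N = p ^ (s * d)"
    using card_carrier[OF J nonzero] by (simp add: N_def power_mult[symmetric] mult.commute)
  \<comment> \<open>In the zero ring every power of \<pi> would be zero. Nontriviality supplies the
    two elements per line that the net requires.\<close>
  have "\<one>\<^bsub>R\<^esub> \<noteq> \<zero>\<^bsub>R\<^esub>"
    using nonzero nat_pow_closed[OF assms(8), of "s - 1"] by (metis l_one l_null)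
  from line_net_plane[OF R(2) this J assms(22)]
  interpret line_net "plane_group R" N "p ^ d" "\<lambda>i. line R (a i)"
    by (simp add: N_def)
  \<comment> \<open>The case distinction of \<open>off_slope\<close> on slopes is moved inside the
    labelling \<open>a\<close>, to match the positions used in the net.\<close>
  have cosets: "in_distinct_cosets (plane_group R)
      (line R (a (if i < j then \<kappa> i else w + \<kappa> i - 1))) (T i j)"
    if "i \<le> z\<^sub>1" "j \<le> z\<^sub>1" "i \<noteq> j" for i j
    using assms(26)[OF that] by (simp add: off_slope_def if_distrib[of a])
  interpret net_family "plane_group R" N "p ^ d" "\<lambda>i. line R (a i)" w z\<^sub>1 z\<^sub>2 \<kappa> T
    using assms(15-17,19,23-25) cosets by unfold_locales simp_all
  have S: "S i j = fam i j" if "i < z\<^sub>1 + 1" "j < z\<^sub>1 + 1" for i j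
    using assms(27)[of i j] that
    by (simp add: constructed_family_def fam_def b_def off_slope_def if_distrib[of a]
        del: line.simps one_DirProd)
  have iff: "partial_sum_family_with (plane_group R) S (z\<^sub>1 + 1) n k l \<mu> t \<longleftrightarrow>
     (z\<^sub>2 = w \<or> z\<^sub>2 + 1 = w) \<and>
     n = N * N \<and> k = (N - 1) * w + z\<^sub>1 * z\<^sub>2 * N \<and>
     l = int N + (int w)\<^sup>2 - 3 * int w + int z\<^sub>1 * (int z\<^sub>2)\<^sup>2 \<and>
     \<mu> = (int w)\<^sup>2 - int w + int z\<^sub>1 * (int z\<^sub>2)\<^sup>2 \<and>
     t = int N * int w - int w + int z\<^sub>1 * (int z\<^sub>2)\<^sup>2" for n k l \<mu> t
    using partial_sum_family_with_cong[of "z\<^sub>1 + 1" S fam] S partial_sum_family_iff by blast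
  have NN: "N * N = p ^ (2 * s * d)"
    using power_add[of p "s * d" "s * d"] by (simp add: N mult_2 distrib_right)
  have intN: "int N = int p ^ (s * d)"
    by (simp add: N)
  have ex: "is_partial_sum_family (plane_group R) (z\<^sub>1 + 1) S \<longleftrightarrow> z\<^sub>2 = w \<or> z\<^sub>2 + 1 = w"
    unfolding is_partial_sum_family_def iff by blast
  \<comment> \<open>Since \<open>z\<^sub>2\<close> is positive, \<open>z\<^sub>2 + 1 = w\<close> is
    possible only for \<open>w \<ge> 2\<close>; for \<open>w = 1\<close> only
    \<open>z\<^sub>2 = w\<close> remains.\<close>
  have "(z\<^sub>2 = w \<or> z\<^sub>2 + 1 = w) \<longleftrightarrow> (2 \<le> w \<longrightarrow> z\<^sub>2 \<in> {w - 1, w}) \<and> (w = 1 \<longrightarrow> z\<^sub>2 = 1)"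
    using z\<^sub>2 w(1) by auto
  then show ?thesis
    unfolding ex iff NN intN using N by auto
qed

end
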